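(* Let $H$ be a locally compact group with a left Haar measure $\mu$, let $p$ be a bounded exponent on $H$, and let $\mathcal{L}^{p(\cdot)}(H)$ be a variable Lebesgue algebra. Then $\mathcal{L}^{p(\cdot)}(H)$ contains an identity (an element $h$ with $f \star h = h \star f = f$ for all $f \in \mathcal{L}^{p(\cdot)}(H)$) if and only if $H$ is discrete.
   Context: $H$ is a locally compact group with left Haar measure $\mu$, and $\mathcal{M}$ denotes the set of $\mu$-measurable functions from $H$ into $\mathbb{C}$ or into $[-\infty,\infty]$, with functions equal $\mu$-a.e. identified. An exponent is a $\mu$-measurable function $p : H \to [1,\infty]$; it is bounded if $p_+ = \operatorname{ess\,sup}_H p(x) < \infty$. Put $F_p = \{x \in H : p(x) < \infty\}$ and, for $f \in \mathcal{M}$, $$\rho_p(f) = \int_{F_p} |f(x)|^{p(x)}\, d\mu(x) + \operatorname{ess\,sup}_{x \in F_p^c} |f(x)|.$$ The variable Lebesgue space is $\mathcal{L}^{p(\cdot)}(H) = \{ f \in \mathcal{M} : \rho_p(f/\lambda) < \infty \text{ for some } \lambda > 0\}$, with norm $\|f\|_{p(\cdot)} = \inf\{ t > 0 : \rho_p(f/t) \leq 1\}$. The convolution is $(f \star g)(x) = \int_H f(y)\, g(y^{-1}x)\, d\mu(y)$. We say $\mathcal{L}^{p(\cdot)}(H)$ is a variable Lebesgue algebra if $(\mathcal{L}^{p(\cdot)}(H), \|\cdot\|_{p(\cdot)})$ is a Banach algebra with respect to this convolution. *)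

theory Defs
  imports "HOL-Probability.Probability"
begin

(* The group is a type of class topological_group_add. Its operation is written + but is not
   assumed to be commutative, so y^(-1)x reads "- y + x". *)

(* Haar measures are Borel measures with the usual Radon regularity. The mu-measurable sets and
   functions are those of "completion \<mu>", and the definitions after this one are meant to be
   used with M = completion \<mu>. *)
definition left_haar_measure :: "'a::{t2_space,topological_group_add} measure \<Rightarrow> bool" where
  "left_haar_measure \<mu> \<longleftrightarrow>
     sets \<mu> = sets borel \<and>
     emeasure \<mu> UNIV \<noteq> 0 \<and>
     (\<forall>K. compact K \<longrightarrow> emeasure \<mu> K < \<infinity>) \<and>
     (\<forall>A\<in>sets borel. emeasure \<mu> A = (INF U\<in>{U. open U \<and> A \<subseteq> U}. emeasure \<mu> U)) \<and>
     (\<forall>U. open U \<longrightarrow> emeasure \<mu> U = (SUP K\<in>{K. compact K \<and> K \<subseteq> U}. emeasure \<mu> K)) \<and>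
     (\<forall>a. \<forall>A\<in>sets borel. emeasure \<mu> ((\<lambda>x. a + x) ` A) = emeasure \<mu> A)"

definition exponent :: "'a measure \<Rightarrow> ('a \<Rightarrow> ennreal) \<Rightarrow> bool" where
  "exponent M p \<longleftrightarrow> p \<in> borel_measurable M \<and> (\<forall>x\<in>space M. 1 \<le> p x)"

definition bounded_exponent :: "'a measure \<Rightarrow> ('a \<Rightarrow> ennreal) \<Rightarrow> bool" where
  "bounded_exponent M p \<longleftrightarrow> exponent M p \<and> esssup M p < \<infinity>"

(* The essential supremum over a null (or empty) set is 0, being taken in [0,\<infinity>]. *)
definition modular :: "'a measure \<Rightarrow> ('a \<Rightarrow> ennreal) \<Rightarrow> ('a \<Rightarrow> complex) \<Rightarrow> ennreal" where
  "modular M p f =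
     (\<integral>\<^sup>+x\<in>{x\<in>space M. p x < \<infinity>}. ennreal (norm (f x) powr enn2real (p x)) \<partial>M) +
     esssup (restrict_space M {x\<in>space M. p x = \<infinity>}) (\<lambda>x. ennreal (norm (f x)))"

(* Elements are representatives; the identification of functions equal almost everywhere is made
   by working modulo ae_eq below. A function with values in [-\<infinity>,\<infinity>] for which the modular of some
   f/\<lambda> is finite is finite almost everywhere, so complex-valued representatives give the whole
   space. *)
definition var_Lp :: "'a measure \<Rightarrow> ('a \<Rightarrow> ennreal) \<Rightarrow> ('a \<Rightarrow> complex) set" where
  "var_Lp M p =
     {f \<in> borel_measurable M. \<exists>t::real. t > 0 \<and> modular M p (\<lambda>x. f x / of_real t) < \<infinity>}"

definition var_Lp_norm :: "'a measure \<Rightarrow> ('a \<Rightarrow> ennreal) \<Rightarrow> ('a \<Rightarrow> complex) \<Rightarrow> real" where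
  "var_Lp_norm M p f = Inf {t::real. t > 0 \<and> modular M p (\<lambda>x. f x / of_real t) \<le> 1}"

definition ae_eq :: "'a measure \<Rightarrow> ('a \<Rightarrow> 'b) \<Rightarrow> ('a \<Rightarrow> 'b) \<Rightarrow> bool" where
  "ae_eq M f g \<longleftrightarrow> (AE x in M. f x = g x)"

definition convolution ::
    "'a::group_add measure \<Rightarrow> ('a \<Rightarrow> complex) \<Rightarrow> ('a \<Rightarrow> complex) \<Rightarrow> 'a \<Rightarrow> complex" where
  "convolution M f g x = (LINT y|M. f y * g (- y + x))"

(* "V modulo eqv, with norm nrm and product mult, is a complex Banach algebra", for a space V of
   functions with pointwise addition and scalar multiplication. *)
locale banach_algebra_modulo =
  fixes V :: "('a \<Rightarrow> complex) set"
    and eqv :: "('a \<Rightarrow> complex) \<Rightarrow> ('a \<Rightarrow> complex) \<Rightarrow> bool"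
    and nrm :: "('a \<Rightarrow> complex) \<Rightarrow> real"
    and mult :: "('a \<Rightarrow> complex) \<Rightarrow> ('a \<Rightarrow> complex) \<Rightarrow> 'a \<Rightarrow> complex"
  assumes eqv_refl: "f \<in> V \<Longrightarrow> eqv f f"
    and eqv_sym: "f \<in> V \<Longrightarrow> g \<in> V \<Longrightarrow> eqv f g \<Longrightarrow> eqv g f"
    and eqv_trans: "f \<in> V \<Longrightarrow> g \<in> V \<Longrightarrow> k \<in> V \<Longrightarrow> eqv f g \<Longrightarrow> eqv g k \<Longrightarrow> eqv f k"
    and zero_closed: "(\<lambda>x. 0) \<in> V"
    and add_closed: "f \<in> V \<Longrightarrow> g \<in> V \<Longrightarrow> (\<lambda>x. f x + g x) \<in> V"
    and scale_closed: "f \<in> V \<Longrightarrow> (\<lambda>x. c * f x) \<in> V"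
    and mult_closed: "f \<in> V \<Longrightarrow> g \<in> V \<Longrightarrow> mult f g \<in> V"
    and add_cong: "f \<in> V \<Longrightarrow> f' \<in> V \<Longrightarrow> g \<in> V \<Longrightarrow> g' \<in> V \<Longrightarrow> eqv f f' \<Longrightarrow> eqv g g' \<Longrightarrow>
          eqv (\<lambda>x. f x + g x) (\<lambda>x. f' x + g' x)"
    and scale_cong: "f \<in> V \<Longrightarrow> f' \<in> V \<Longrightarrow> eqv f f' \<Longrightarrow> eqv (\<lambda>x. c * f x) (\<lambda>x. c * f' x)"
    and mult_cong: "f \<in> V \<Longrightarrow> f' \<in> V \<Longrightarrow> g \<in> V \<Longrightarrow> g' \<in> V \<Longrightarrow> eqv f f' \<Longrightarrow> eqv g g' \<Longrightarrow>
          eqv (mult f g) (mult f' g')"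
    and nrm_cong: "f \<in> V \<Longrightarrow> f' \<in> V \<Longrightarrow> eqv f f' \<Longrightarrow> nrm f = nrm f'"
    and mult_assoc: "f \<in> V \<Longrightarrow> g \<in> V \<Longrightarrow> k \<in> V \<Longrightarrow> eqv (mult (mult f g) k) (mult f (mult g k))"
    and mult_add_left: "f \<in> V \<Longrightarrow> g \<in> V \<Longrightarrow> k \<in> V \<Longrightarrow>
          eqv (mult (\<lambda>x. f x + g x) k) (\<lambda>x. mult f k x + mult g k x)"
    and mult_add_right: "f \<in> V \<Longrightarrow> g \<in> V \<Longrightarrow> k \<in> V \<Longrightarrow>
          eqv (mult f (\<lambda>x. g x + k x)) (\<lambda>x. mult f g x + mult f k x)"
    and mult_scale_left: "f \<in> V \<Longrightarrow> g \<in> V \<Longrightarrow> eqv (mult (\<lambda>x. c * f x) g) (\<lambda>x. c * mult f g x)"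
    and mult_scale_right: "f \<in> V \<Longrightarrow> g \<in> V \<Longrightarrow> eqv (mult f (\<lambda>x. c * g x)) (\<lambda>x. c * mult f g x)"
    and nrm_nonneg: "f \<in> V \<Longrightarrow> 0 \<le> nrm f"
    and nrm_eq_zero: "f \<in> V \<Longrightarrow> nrm f = 0 \<longleftrightarrow> eqv f (\<lambda>x. 0)"
    and nrm_scale: "f \<in> V \<Longrightarrow> nrm (\<lambda>x. c * f x) = norm c * nrm f"
    and nrm_triangle: "f \<in> V \<Longrightarrow> g \<in> V \<Longrightarrow> nrm (\<lambda>x. f x + g x) \<le> nrm f + nrm g"
    and nrm_mult: "f \<in> V \<Longrightarrow> g \<in> V \<Longrightarrow> nrm (mult f g) \<le> nrm f * nrm g"
    and complete: "(\<And>n::nat. F n \<in> V) \<Longrightarrow>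
          (\<And>e. e > 0 \<Longrightarrow> \<exists>N. \<forall>m\<ge>N. \<forall>n\<ge>N. nrm (\<lambda>x. F m x - F n x) < e) \<Longrightarrow>
          \<exists>f\<in>V. (\<lambda>n. nrm (\<lambda>x. F n x - f x)) \<longlonglongrightarrow> 0"

(* The Bochner integral of a non-integrable function is 0, so the existence of the convolution
   (almost everywhere) has to be required separately. *)
definition variable_lebesgue_algebra ::
    "'a::group_add measure \<Rightarrow> ('a \<Rightarrow> ennreal) \<Rightarrow> bool" where
  "variable_lebesgue_algebra M p \<longleftrightarrow>
     (\<forall>f\<in>var_Lp M p. \<forall>g\<in>var_Lp M p. AE x in M. integrable M (\<lambda>y. f y * g (- y + x))) \<and>
     banach_algebra_modulo (var_Lp M p) (ae_eq M) (var_Lp_norm M p) (convolution M)"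

definition convolution_identity ::
    "'a::group_add measure \<Rightarrow> ('a \<Rightarrow> ennreal) \<Rightarrow> ('a \<Rightarrow> complex) \<Rightarrow> bool" where
  "convolution_identity M p h \<longleftrightarrow>
     h \<in> var_Lp M p \<and>
     (\<forall>f\<in>var_Lp M p. ae_eq M (convolution M f h) f \<and> ae_eq M (convolution M h f) f)"

end

theory Submission
  imports Defs
begin

text \<open>On a non-discrete group points are null, so by outer regularity the neighbourhoods U of 0
  have arbitrarily small measure. Since p is at least 1 and finite almost everywhere, an element h
  of the space is locally integrable, hence the integral of |h| over a suitable U is less than 1.
  For a neighbourhood V of 0 with V - V contained in U, the value at x in V of the convolution of h
  with the indicator of V is at most this integral, so h is not an identity. On a discrete group the
  normalised indicator of 0 is an identity.\<close>

section \<open>Topological groups: translations, differences near 0, discreteness\<close>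

lemma open_translation_group:
  fixes U :: "'a::topological_group_add set"
  assumes "open U"
  shows "open ((\<lambda>x. a + x) ` U)"
proof -
  \<comment> \<open>The image under translation by \<open>a\<close> is the preimage under its
    inverse, translation by \<open>- a\<close>, which is continuous.\<close>
  have "(\<lambda>x. a + x) ` U = (\<lambda>x. - a + x) -` U"
  proof (intro set_eqI iffI)
    fix x assume "x \<in> (\<lambda>x. - a + x) -` U"
    then have "x = a + (- a + x)" "- a + x \<in> U"
      by (simp_all add: add.assoc[symmetric])
    then show "x \<in> (\<lambda>x. a + x) ` U" by blast
  qed (auto simp: add.assoc[symmetric])
  moreover have "open ((\<lambda>x. - a + x) -` U)"
    by (intro open_vimage assms continuous_intros)
  ultimately show ?thesis by simp
qed

text \<open>This is continuity of subtraction at \<open>(0, 0)\<close>: the open preimage of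
  \<open>U\<close> contains a box \<open>A \<times> B\<close> around that point, and
  \<open>A \<inter> B\<close> serves as \<open>V\<close>.\<close>

lemma open_zero_diff_subset:
  fixes U :: "'a::topological_group_add set"
  assumes "open U" "0 \<in> U"
  obtains V where "open V" "0 \<in> V" "\<And>x y. x \<in> V \<Longrightarrow> y \<in> V \<Longrightarrow> x - y \<in> U"
proof -
  define S where "S = (\<lambda>z::'a \<times> 'a. fst z + - snd z) -` U"
  have "open S"
    unfolding S_def by (intro open_vimage assms continuous_intros)
  moreover have "(0, 0) \<in> S"
    using assms(2) by (simp add: S_def)
  ultimately obtain A B
    where AB: "open A" "open B" "(0, 0) \<in> A \<times> B" "A \<times> B \<subseteq> S"
    by (rule open_prod_elim)
  show thesis
  proof (rule that)
    show "open (A \<inter> B)" "0 \<in> A \<inter> B" using AB by auto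
    fix x y assume "x \<in> A \<inter> B" "y \<in> A \<inter> B"
    then have "(x, y) \<in> S" using AB(4) by blast
    then show "x - y \<in> U" by (simp add: S_def)
  qed
qed

lemma euclidean_eq_discrete_topology_iff:
  "(euclidean :: 'a::topological_group_add topology) = discrete_topology UNIV \<longleftrightarrow> open {0::'a}"
proof
  assume "(euclidean :: 'a topology) = discrete_topology UNIV"
  then have "openin (euclidean :: 'a topology) {0}" by simp
  then show "open {0::'a}" by simp
next
  assume "open {0::'a}"
  then have "open {a}" for a :: 'a
    using open_translation_group[of "{0}" a] by simp
  then have "discrete_topology UNIV = (euclidean :: 'a topology)"
    unfolding discrete_topology_unique by simp
  then show "(euclidean :: 'a topology) = discrete_topology UNIV" by simp
qed

section \<open>Haar measure of points and of neighbourhoods of 0\<close>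

context
  fixes \<mu> :: "'a::{t2_space,topological_group_add} measure"
  assumes haar: "left_haar_measure \<mu>"
begin

lemma haar_sets: "sets \<mu> = sets borel"
  using haar by (simp add: left_haar_measure_def)

lemma haar_outer_regular:
  "A \<in> sets borel \<Longrightarrow> emeasure \<mu> A = (INF U\<in>{U. open U \<and> A \<subseteq> U}. emeasure \<mu> U)"
  using haar by (simp add: left_haar_measure_def)

lemma haar_compact_finite: "compact K \<Longrightarrow> emeasure \<mu> K < \<infinity>"
  using haar by (simp add: left_haar_measure_def)

lemma haar_translation: "A \<in> sets borel \<Longrightarrow> emeasure \<mu> ((\<lambda>x. a + x) ` A) = emeasure \<mu> A"
  using haar by (simp add: left_haar_measure_def)

lemma haar_singleton: "emeasure \<mu> {a} = emeasure \<mu> {0}"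
  using haar_translation[of "{0}" a] by simp

text \<open>If \<open>U\<close> were null, so would be its translates, finitely many of which cover
  any given compact set. All compact sets would then be null, and inner regularity on
  \<open>UNIV\<close> would make the whole measure 0.\<close>

lemma haar_open_pos:
  assumes "open U" "0 \<in> U"
  shows "emeasure \<mu> U > 0"
proof (rule ccontr)
  assume "\<not> ?thesis"
  then have U0: "emeasure \<mu> U = 0" by simp
  have "emeasure \<mu> K = 0" if K: "compact K" for K
  proof -
    have cover: "K \<subseteq> (\<Union>a\<in>K. (\<lambda>x. a + x) ` U)"
      using assms(2) by force
    obtain C where C: "C \<subseteq> K" "finite C" "K \<subseteq> (\<Union>a\<in>C. (\<lambda>x. a + x) ` U)"
      using compactE_image[OF K, of K "\<lambda>a. (\<lambda>x. a + x) ` U"] cover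
        open_translation_group[OF assms(1)] by blast
    have meas: "(\<lambda>x. a + x) ` U \<in> sets \<mu>" for a
      using open_translation_group[OF assms(1)] by (simp add: haar_sets)
    have "emeasure \<mu> K \<le> emeasure \<mu> (\<Union>a\<in>C. (\<lambda>x. a + x) ` U)"
      using C(2) meas by (intro emeasure_mono C(3)) auto
    also have "\<dots> \<le> (\<Sum>a\<in>C. emeasure \<mu> ((\<lambda>x. a + x) ` U))"
      using meas by (intro emeasure_subadditive_finite C(2)) auto
    also have "\<dots> = 0"
      using assms(1) by (simp add: haar_translation U0)
    finally show ?thesis by simp
  qed
  moreover have "emeasure \<mu> UNIV = (SUP K\<in>{K. compact K \<and> K \<subseteq> UNIV}. emeasure \<mu> K)"
    using haar unfolding left_haar_measure_def by blast
  ultimately have "emeasure \<mu> UNIV \<le> 0"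
    by (simp only:) (rule SUP_least, simp)
  then show False
    using haar by (simp add: left_haar_measure_def)
qed

lemma haar_finite_neighbourhood:
  assumes "locally_compact_space (euclidean :: 'a topology)"
  obtains U where "open U" "0 \<in> U" "emeasure \<mu> U < \<infinity>"
proof -
  obtain U K where UK: "open U" "compact K" "(0::'a) \<in> U" "U \<subseteq> K"
    using assms unfolding locally_compact_space_def by simp metis
  have "emeasure \<mu> U \<le> emeasure \<mu> K"
    using UK(2,4) by (intro emeasure_mono) (auto simp: haar_sets borel_compact)
  with haar_compact_finite[OF UK(2)] have "emeasure \<mu> U < \<infinity>"
    by (rule order.strict_trans1[rotated])
  with UK that show thesis by blast
qed

text \<open>By invariance all points have the same mass. Were it positive, a neighbourhood of finite
  measure, which is infinite in the non-discrete case, would contain arbitrarily many points of that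
  mass.\<close>

lemma haar_point_null:
  assumes lc: "locally_compact_space (euclidean :: 'a topology)"
    and nd: "\<not> open {0::'a}"
  shows "emeasure \<mu> {0} = 0"
proof (rule ccontr)
  assume c: "emeasure \<mu> {0} \<noteq> 0"
  obtain U where U: "open U" "0 \<in> U" "emeasure \<mu> U < \<infinity>"
    using haar_finite_neighbourhood[OF lc] .
  \<comment> \<open>Finite sets are closed in a Hausdorff space, so removing the other points of a
    finite \<open>U\<close> would leave \<open>{0}\<close> open.\<close>
  have "infinite U"
  proof
    assume "finite U"
    then have "open (U - (U - {0}))"
      by (intro open_Diff U finite_imp_closed) auto
    moreover have "U - (U - {0}) = {0}" using U(2) by auto
    ultimately show False using nd by simp
  qed
  have bound: "of_nat n * emeasure \<mu> {0} \<le> emeasure \<mu> U" for n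
  proof -
    obtain F where F: "finite F" "card F = n" "F \<subseteq> U"
      using infinite_arbitrarily_large[OF \<open>infinite U\<close>] by blast
    have "of_nat n * emeasure \<mu> {0} = (\<Sum>a\<in>F. emeasure \<mu> {a})"
      unfolding F(2)[symmetric] sum_constant[symmetric]
      by (intro sum.cong refl haar_singleton[symmetric])
    also have "\<dots> = emeasure \<mu> F"
      using F(1) by (intro emeasure_eq_sum_singleton[symmetric]) (auto simp: haar_sets)
    also have "\<dots> \<le> emeasure \<mu> U"
      using U(1) F(3) by (intro emeasure_mono) (auto simp: haar_sets)
    finally show ?thesis .
  qed
  have "(SUP n. of_nat n * emeasure \<mu> {0}) = \<infinity>"
    using c by (simp add: SUP_mult_right_ennreal[symmetric] ennreal_SUP_of_nat_eq_top ennreal_top_mult)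
  moreover have "(SUP n. of_nat n * emeasure \<mu> {0}) \<le> emeasure \<mu> U"
    by (intro SUP_least bound)
  ultimately have "\<infinity> \<le> emeasure \<mu> U" by (simp only:)
  with U(3) show False by simp
qed

lemma haar_small_neighbourhood:
  assumes "emeasure \<mu> {0} = 0" "e > 0"
  shows "\<exists>U. open U \<and> 0 \<in> U \<and> emeasure \<mu> U < e"
proof -
  have "(INF U\<in>{U. open U \<and> {0} \<subseteq> U}. emeasure \<mu> U) < e"
    using assms haar_outer_regular[of "{0}"] by simp
  then show ?thesis by (auto simp: INF_less_iff)
qed

end

section \<open>Variable Lebesgue spaces: local integrability and indicators\<close>

lemma bounded_exponent_AE_finite:
  assumes "bounded_exponent M p"
  shows "AE x in M. p x < \<infinity>"
  using esssup_AE[of p M] assms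
  by (auto simp: bounded_exponent_def elim!: eventually_mono)

text \<open>For an exponent \<open>q \<ge> 1\<close> and \<open>u \<ge> 0\<close> one has
  \<open>u \<le> 1 + u powr q\<close>. With \<open>u = norm (f x) / t\<close> the 1 integrates to
  the measure of \<open>A\<close>, and the power is controlled by the modular.\<close>

lemma var_Lp_nn_integral_finite:
  assumes p: "bounded_exponent M p" and f: "f \<in> var_Lp M p"
    and A: "A \<in> sets M" "emeasure M A < \<infinity>"
  shows "(\<integral>\<^sup>+x\<in>A. ennreal (norm (f x)) \<partial>M) < \<infinity>"
proof -
  have [measurable]: "p \<in> borel_measurable M" "f \<in> borel_measurable M"
    using p f by (auto simp: bounded_exponent_def exponent_def var_Lp_def)
  note A(1)[measurable]
  obtain t :: real where t: "t > 0" "modular M p (\<lambda>x. f x / of_real t) < \<infinity>"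
    using f by (auto simp: var_Lp_def)
  define g where "g x = ennreal (norm (f x / of_real t) powr enn2real (p x)) *
    indicator {x\<in>space M. p x < \<infinity>} x" for x
  have [measurable]: "g \<in> borel_measurable M"
    unfolding g_def by measurable
  have g: "(\<integral>\<^sup>+x. g x \<partial>M) < \<infinity>"
    using t(2) unfolding modular_def g_def by (simp add: top_unique)
  have "AE x in M. ennreal (norm (f x)) * indicator A x \<le> ennreal t * (indicator A x + g x)"
    using bounded_exponent_AE_finite[OF p] AE_space
  proof eventually_elim
    case (elim x)
    define u where "u = norm (f x) / t"
    have u: "norm (f x / of_real t) = u" "norm (f x) = t * u" "u \<ge> 0"
      using t(1) by (auto simp: u_def norm_divide)
    \<comment> \<open>Finiteness of \<open>p x\<close> matters here, since \<open>enn2real\<close>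
      sends infinity to 0.\<close>
    have "1 \<le> enn2real (p x)"
      using p elim enn2real_mono[of 1 "p x"] by (auto simp: bounded_exponent_def exponent_def)
    then have "u \<le> 1 + u powr enn2real (p x)"
      using powr_mono[of 1 "enn2real (p x)" u] u(3) by (cases "u \<le> 1") (auto simp: add_increasing2)
    then have "t * u \<le> t * (1 + u powr enn2real (p x))"
      using t(1) by simp
    then have "ennreal (norm (f x)) \<le> ennreal t * (1 + g x)"
      using elim t(1) u by (simp add: g_def ennreal_leI flip: ennreal_mult ennreal_plus ennreal_1)
    then show ?case by (auto split: split_indicator)
  qed
  then have "(\<integral>\<^sup>+x\<in>A. ennreal (norm (f x)) \<partial>M) \<le> (\<integral>\<^sup>+x. ennreal t * (indicator A x + g x) \<partial>M)"
    by (rule nn_integral_mono_AE)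
  also have "\<dots> = ennreal t * (emeasure M A + (\<integral>\<^sup>+x. g x \<partial>M))"
    by (simp add: nn_integral_cmult nn_integral_add)
  also have "\<dots> < \<infinity>"
    using A(2) g by (simp add: ennreal_mult_less_top)
  finally show ?thesis .
qed

text \<open>The scale \<open>t = 1\<close> works: powers of an indicator do not exceed the
  indicator, so the integral is at most the measure of \<open>A\<close>, and the essential supremum
  is at most 1.\<close>

lemma indicator_in_var_Lp:
  assumes p: "exponent M p" and A: "A \<in> sets M" "emeasure M A < \<infinity>"
  shows "indicator A \<in> var_Lp M p"
proof -
  have [measurable]: "p \<in> borel_measurable M"
    using p by (simp add: exponent_def)
  note A(1)[measurable]
  have eq: "(\<lambda>x. ennreal (norm (indicator A x :: complex))) = indicator A"
    by (auto split: split_indicator)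
  have "(\<integral>\<^sup>+x\<in>{x\<in>space M. p x < \<infinity>}.
      ennreal (norm (indicator A x :: complex) powr enn2real (p x)) \<partial>M) \<le> (\<integral>\<^sup>+x. indicator A x \<partial>M)"
    by (intro nn_integral_mono) (auto split: split_indicator)
  also have "\<dots> < \<infinity>" using A by simp
  finally have 1: "(\<integral>\<^sup>+x\<in>{x\<in>space M. p x < \<infinity>}.
      ennreal (norm (indicator A x :: complex) powr enn2real (p x)) \<partial>M) < \<infinity>" .
  have "esssup (restrict_space M {x\<in>space M. p x = \<infinity>}) (indicator A) \<le> (1::ennreal)"
    by (intro esssup_I measurable_restrict_space1) (auto split: split_indicator)
  also have "\<dots> < \<infinity>" by simp
  finally have "modular M p (\<lambda>x. indicator A x / of_real 1) < \<infinity>"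
    using 1 unfolding modular_def by (simp add: eq)
  then have "\<exists>t::real. t > 0 \<and> modular M p (\<lambda>x. indicator A x / of_real t) < \<infinity>"
    using zero_less_one by blast
  then show ?thesis
    unfolding var_Lp_def by simp
qed

section \<open>Identities for convolution: the non-discrete and the discrete case\<close>

lemma no_identity_nondiscrete:
  fixes \<mu> :: "'a::{t2_space,topological_group_add} measure"
  assumes lc: "locally_compact_space (euclidean :: 'a topology)"
    and haar: "left_haar_measure \<mu>"
    and p: "bounded_exponent (completion \<mu>) p"
    and nd: "\<not> open {0::'a}"
    and h: "convolution_identity (completion \<mu>) p h"
  shows False
proof -
  define M where "M = completion \<mu>"
  have hV: "h \<in> var_Lp M p" and p': "exponent M p"
    using h p by (auto simp: convolution_identity_def bounded_exponent_def M_def)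
  then have [measurable]: "h \<in> borel_measurable M"
    by (simp add: var_Lp_def)
  have open_sets: "U \<in> sets M" "emeasure M U = emeasure \<mu> U" if "open U" for U
    using that by (auto simp: M_def haar_sets[OF haar])
  obtain U where U: "open U" "0 \<in> U" "emeasure \<mu> U < \<infinity>"
    using haar_finite_neighbourhood[OF haar lc] .
  have "\<exists>W. open W \<and> 0 \<in> W \<and> emeasure \<mu> W < ennreal (1 / Suc n)" for n
    using haar_small_neighbourhood[OF haar haar_point_null[OF haar lc nd]] by simp
  then obtain W where W: "\<And>n. open (W n)" "\<And>n. 0 \<in> W n"
      "\<And>n. emeasure \<mu> (W n) < ennreal (1 / Suc n)"
    by metis
  \<comment> \<open>The finite intersections make the sequence decreasing, and \<open>U\<close>
    keeps its measures finite. The \<open>A n\<close> need not form a neighbourhood base: a null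
    intersection is enough for continuity from above.\<close>
  define A where "A n = U \<inter> (\<Inter>k\<le>n. W k)" for n
  have A: "open (A n)" "0 \<in> A n" for n
    using U W by (auto simp: A_def)
  have A_sets: "A n \<in> sets M" for n
    using A(1) open_sets by blast
  have Int_null: "emeasure M (\<Inter>n. A n) = 0"
  proof -
    have "emeasure M (\<Inter>n. A n) \<le> ennreal (1 / Suc n)" for n
    proof -
      have "emeasure M (\<Inter>n. A n) \<le> emeasure M (W n)"
        using open_sets W(1) by (intro emeasure_mono) (auto simp: A_def)
      also have "\<dots> \<le> ennreal (1 / Suc n)"
        using open_sets(2)[OF W(1)] W(3) by (simp add: less_imp_le)
      finally show ?thesis .
    qed
    moreover have "(\<lambda>n. ennreal (1 / Suc n)) \<longlonglongrightarrow> ennreal 0"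
      by (intro tendsto_ennrealI LIMSEQ_Suc lim_1_over_n)
    ultimately have "emeasure M (\<Inter>n. A n) \<le> ennreal 0"
      by (intro LIMSEQ_le_const) auto
    then show ?thesis by simp
  qed
  \<comment> \<open>Treating the integral of \<open>norm (h x)\<close> over a set as a measure makes
    continuity from above available: \<open>\<nu> (A n)\<close> tends to 0.\<close>
  define \<nu> where "\<nu> = density M (\<lambda>x. ennreal (norm (h x)))"
  have \<nu>: "emeasure \<nu> B = (\<integral>\<^sup>+x\<in>B. ennreal (norm (h x)) \<partial>M)" if "B \<in> sets M" for B
    using that by (simp add: \<nu>_def emeasure_density)
  have "(\<lambda>n. emeasure \<nu> (A n)) \<longlonglongrightarrow> emeasure \<nu> (\<Inter>n. A n)"
  proof (rule Lim_emeasure_decseq)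
    show "range A \<subseteq> sets \<nu>" using A_sets by (auto simp: \<nu>_def)
    show "decseq A" by (rule decseq_SucI) (auto simp: A_def atMost_Suc)
    fix n
    have "emeasure M (A n) \<le> emeasure M U"
      using U(1) open_sets by (intro emeasure_mono) (auto simp: A_def)
    then have "emeasure M (A n) < \<infinity>"
      using U by (simp add: open_sets order.strict_trans1)
    then show "emeasure \<nu> (A n) \<noteq> \<infinity>"
      using var_Lp_nn_integral_finite[OF p[folded M_def] hV A_sets] \<nu>[OF A_sets] by fastforce
  qed
  moreover have "(\<Inter>n. A n) \<in> null_sets M"
    using Int_null A_sets by (intro null_setsI) auto
  then have "emeasure \<nu> (\<Inter>n. A n) = 0"
    using A_sets by (subst \<nu>) (auto intro!: nn_integral_null_set)
  ultimately have "eventually (\<lambda>n. emeasure \<nu> (A n) < 1) sequentially"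
    by (intro order_tendstoD(2)) auto
  then obtain n where n: "emeasure \<nu> (A n) < 1"
    by (auto dest: eventually_happens)
  obtain V' where V': "open V'" "0 \<in> V'" "\<And>x y. x \<in> V' \<Longrightarrow> y \<in> V' \<Longrightarrow> x - y \<in> A n"
    using open_zero_diff_subset[OF A] by blast
  \<comment> \<open>Intersecting with \<open>U\<close> gives finite measure, which puts the
    indicator of \<open>V\<close> in the space.\<close>
  define V where "V = V' \<inter> U"
  have V: "open V" "0 \<in> V" "\<And>x y. x \<in> V \<Longrightarrow> y \<in> V \<Longrightarrow> x - y \<in> A n"
    using V' U by (auto simp: V_def)
  have "emeasure M V \<le> emeasure M U"
    using U(1) open_sets by (intro emeasure_mono) (auto simp: V_def)
  then have "emeasure M V < \<infinity>"
    using U by (simp add: open_sets order.strict_trans1)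
  then have "indicator V \<in> var_Lp M p"
    using p' V(1) open_sets by (intro indicator_in_var_Lp) auto
  then have "AE x in M. convolution M h (indicator V) x = indicator V x"
    using h unfolding convolution_identity_def ae_eq_def M_def by blast
  moreover have "convolution M h (indicator V) x \<noteq> 1" if "x \<in> V" for x
  proof
    assume eq: "convolution M h (indicator V) x = 1"
    \<comment> \<open>A non-integrable function has Bochner integral 0, so the value 1 forces
      integrability.\<close>
    then have "integrable M (\<lambda>y. h y * indicator V (- y + x))"
      unfolding convolution_def using not_integrable_integral_eq by fastforce
    then have "ennreal (norm (convolution M h (indicator V) x)) \<le>
        (\<integral>\<^sup>+y. ennreal (norm (h y * indicator V (- y + x))) \<partial>M)"
      unfolding convolution_def by (rule integral_norm_bound_ennreal)
    also have "\<dots> \<le> (\<integral>\<^sup>+y\<in>A n. ennreal (norm (h y)) \<partial>M)"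
    proof (rule nn_integral_mono)
      fix y
      \<comment> \<open>The integrand vanishes unless \<open>- y + x\<close> lies in
        \<open>V\<close>; then \<open>y\<close> is a difference of two elements of \<open>V\<close>.
        The order of the terms matters, as the group may be non-commutative.\<close>
      have "y \<in> A n" if "- y + x \<in> V"
      proof -
        have "x - (- y + x) = y" by (simp add: diff_conv_add_uminus minus_add del: add_uminus_conv_diff)
        then show ?thesis using V(3)[OF \<open>x \<in> V\<close> that] by simp
      qed
      then show "ennreal (norm (h y * indicator V (- y + x))) \<le> ennreal (norm (h y)) * indicator (A n) y"
        by (auto split: split_indicator)
    qed
    also have "\<dots> < 1" using n \<nu>[OF A_sets] by simp
    finally show False using eq by simp
  qed
  \<comment> \<open>On \<open>V\<close> the indicator is 1 and the convolution is not, so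
    \<open>V\<close> lies in the exceptional null set, contradicting
    \<open>haar_open_pos\<close>.\<close>
  ultimately have "AE x in M. x \<notin> V"
    by (auto elim!: eventually_mono)
  then have "emeasure M V = 0"
    using open_sets(1)[OF V(1)] sets.sets_into_space[OF open_sets(1)[OF V(1)]]
    by (subst (asm) AE_iff_measurable[of V]) auto
  then show False
    using haar_open_pos[OF haar V(1,2)] open_sets(2)[OF V(1)] by simp
qed

text \<open>The identity is the indicator of \<open>{0}\<close> divided by the common mass
  \<open>c\<close> of the points. Integrating against a point indicator evaluates at that point and
  multiplies by \<open>c\<close>, so both identity equations hold at every \<open>x\<close>.\<close>

lemma identity_discrete:
  fixes \<mu> :: "'a::{t2_space,topological_group_add} measure"
  assumes haar: "left_haar_measure \<mu>"
    and p: "exponent (completion \<mu>) p"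
    and scale: "\<And>c f. f \<in> var_Lp (completion \<mu>) p \<Longrightarrow> (\<lambda>x. c * f x) \<in> var_Lp (completion \<mu>) p"
    and discrete: "open {0::'a}"
  shows "\<exists>h. convolution_identity (completion \<mu>) p h"
proof -
  define M where "M = completion \<mu>"
  have sets: "{x} \<in> sets M" for x
    by (simp add: M_def haar_sets[OF haar])
  have em: "emeasure M {x} = emeasure \<mu> {0}" for x
    using haar_singleton[OF haar, of x] by (simp add: M_def haar_sets[OF haar])
  have fin: "emeasure M {x} < \<infinity>" for x
    unfolding em using haar_compact_finite[OF haar] by simp
  define c where "c = measure M {0}"
  have meas: "measure M {x} = c" for x
    by (simp add: c_def measure_def em)
  \<comment> \<open>Positivity comes from \<open>{0}\<close> being open; finiteness is needed too,
    because \<open>measure\<close> returns 0 on infinite mass.\<close>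
  have "c \<noteq> 0"
    using haar_open_pos[OF haar discrete] fin[of 0]
    by (auto simp: c_def measure_def em enn2real_eq_0_iff)
  have point: "(LINT y|M. a * indicator {x} y) = c * a" for a :: complex and x
  proof -
    have "(LINT y|M. indicator {x} y *\<^sub>R a) = measure M {x} *\<^sub>R a"
      by (intro has_bochner_integral_integral_eq has_bochner_integral_indicator sets fin)
    moreover have "(\<lambda>y. indicator {x} y *\<^sub>R a) = (\<lambda>y. a * indicator {x} y)"
      by (auto split: split_indicator)
    ultimately show ?thesis
      by (simp only: meas scaleR_conv_of_real)
  qed
  define h :: "'a \<Rightarrow> complex" where "h x = 1 / complex_of_real c * indicator {0} x" for x
  have "h \<in> var_Lp M p"
    unfolding h_def M_def
    by (rule scale[OF indicator_in_var_Lp[OF p sets[unfolded M_def] fin[unfolded M_def]]])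
  moreover have "convolution M f h x = f x" for f x
  proof -
    \<comment> \<open>The factor \<open>h (- y + x)\<close> is nonzero exactly at
      \<open>y = x\<close>, so \<open>f y\<close> may be replaced by the constant
      \<open>f x\<close>.\<close>
    have "convolution M f h x = (LINT y|M. (f x / c) * indicator {x} y)"
      unfolding convolution_def
      by (intro Bochner_Integration.integral_cong refl) (simp add: h_def indicator_def add_eq_0_iff)
    also have "\<dots> = f x"
      unfolding point using \<open>c \<noteq> 0\<close> by simp
    finally show ?thesis .
  qed
  moreover have "convolution M h f x = f x" for f x
  proof -
    have "convolution M h f x = (LINT y|M. (f x / c) * indicator {0} y)"
      unfolding convolution_def
      by (intro Bochner_Integration.integral_cong refl) (simp add: h_def indicator_def)
    also have "\<dots> = f x"
      unfolding point using \<open>c \<noteq> 0\<close> by simp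
    finally show ?thesis .
  qed
  ultimately show ?thesis
    unfolding convolution_identity_def ae_eq_def M_def[symmetric] by auto
qed

theorem theorem4p4:
  fixes \<mu> :: "'a::{t2_space,topological_group_add} measure"
    and p :: "'a \<Rightarrow> ennreal"
  assumes "locally_compact_space (euclidean :: 'a topology)"
    and "left_haar_measure \<mu>"
    and "bounded_exponent (completion \<mu>) p"
    and "variable_lebesgue_algebra (completion \<mu>) p"
  shows "(\<exists>h. convolution_identity (completion \<mu>) p h) \<longleftrightarrow>
         (euclidean :: 'a topology) = discrete_topology UNIV"
proof -
  \<comment> \<open>The algebra structure supplies \<open>scale_closed\<close>, which keeps the
    normalised indicator in the space.\<close>
  interpret banach_algebra_modulo "var_Lp (completion \<mu>) p" "ae_eq (completion \<mu>)"
      "var_Lp_norm (completion \<mu>) p" "convolution (completion \<mu>)"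
    using assms(4) by (simp add: variable_lebesgue_algebra_def)
  have "exponent (completion \<mu>) p"
    using assms(3) by (simp add: bounded_exponent_def)
  then show ?thesis
    unfolding euclidean_eq_discrete_topology_iff
    using no_identity_nondiscrete[OF assms(1-3)] identity_discrete[OF assms(2) _ scale_closed]
    by blast
qed

end
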